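(* Let $G$ be the incidence graph of a $\mathrm{BIBD}(v,b,r,k,1)$ with $k < r$, let $\alpha = \min\{k, r-k\}$, and let $d$ be a positive integer with $d \le \frac{r-2}{\alpha}$ and $$d < \max\left\{k, \frac{2r(k-1)-2}{k+1+2(k-1)\alpha}\right\}.$$ Then $\zeta(G) > d$.
   Context: A $\mathrm{BIBD}(v,b,r,k,\lambda)$ is a set $X$ of $v$ points together with a collection $\mathcal{B}$ of $b$ blocks (subsets of $X$) such that every block has size $k$, every point lies in exactly $r$ blocks, and every pair of distinct points lies in exactly $\lambda$ blocks. Its incidence graph is the bipartite graph on $X \cup \mathcal{B}$ with $x \sim B$ iff $x \in B$. Localization game on a connected graph $G$ with $k$ cops: the robber chooses a starting vertex, invisible to the cops. Each round the cops choose any $k$ vertices (no adjacency restriction) and each learns its distance to the robber; the cops win if after finitely many rounds they determine the robber's vertex uniquely; otherwise the robber moves to a neighbour or stays. The robber knows the cops' strategy. $\zeta(G)$ is the least $k$ for which $k$ cops can guarantee capture. *)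

theory Defs
  imports Complex_Main
begin

text \<open>
  Blocks form a set. For \<open>l = 1\<close> and \<open>k \<ge> 2\<close> this loses nothing, since a repeated block would
  cover a pair twice. Nonemptiness of \<open>X\<close> excludes only the void design, for which \<open>r\<close> would be
  unconstrained.
\<close>

definition bibd :: "'a set \<Rightarrow> 'a set set \<Rightarrow> nat \<Rightarrow> nat \<Rightarrow> nat \<Rightarrow> nat \<Rightarrow> nat \<Rightarrow> bool" where
  "bibd X \<B> v b r k l \<longleftrightarrow>
     finite X \<and> X \<noteq> {} \<and> card X = v \<and>
     (\<forall>B\<in>\<B>. B \<subseteq> X) \<and> card \<B> = b \<and>
     (\<forall>B\<in>\<B>. card B = k) \<and>
     (\<forall>x\<in>X. card {B\<in>\<B>. x \<in> B} = r) \<and>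
     (\<forall>x\<in>X. \<forall>y\<in>X. x \<noteq> y \<longrightarrow> card {B\<in>\<B>. x \<in> B \<and> y \<in> B} = l)"

text \<open>A graph is given by its vertex set and its symmetric adjacency relation.\<close>

definition incidence_verts :: "'a set \<Rightarrow> 'a set set \<Rightarrow> ('a + 'a set) set" where
  "incidence_verts X \<B> = X <+> \<B>"

definition incidence_adj :: "'a set \<Rightarrow> 'a set set \<Rightarrow> ('a + 'a set) rel" where
  "incidence_adj X \<B> =
     {(Inl x, Inr B) | x B. x \<in> X \<and> B \<in> \<B> \<and> x \<in> B} \<union>
     {(Inr B, Inl x) | x B. x \<in> X \<and> B \<in> \<B> \<and> x \<in> B}"

text \<open>Length of a shortest walk; meaningful only for vertices in the same component.\<close>

definition graph_dist :: "'v rel \<Rightarrow> 'v \<Rightarrow> 'v \<Rightarrow> nat" where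
  "graph_dist E u w = (LEAST n. (u, w) \<in> E ^^ n)"

definition robber_play :: "'v set \<Rightarrow> 'v rel \<Rightarrow> (nat \<Rightarrow> 'v) \<Rightarrow> bool" where
  "robber_play V E \<rho> \<longleftrightarrow>
     (\<forall>i. \<rho> i \<in> V) \<and> (\<forall>i. \<rho> (Suc i) = \<rho> i \<or> (\<rho> i, \<rho> (Suc i)) \<in> E)"

text \<open>
  A cop strategy maps the answers received so far (one list of distances per past round) to the
  vertices probed in the next round.
\<close>

definition cop_strategy :: "'v set \<Rightarrow> nat \<Rightarrow> (nat list list \<Rightarrow> 'v list) \<Rightarrow> bool" where
  "cop_strategy V m \<sigma> \<longleftrightarrow> (\<forall>h. length (\<sigma> h) = m \<and> set (\<sigma> h) \<subseteq> V)"

primrec answers :: "'v rel \<Rightarrow> (nat list list \<Rightarrow> 'v list) \<Rightarrow> (nat \<Rightarrow> 'v) \<Rightarrow> nat \<Rightarrow> nat list list" where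
  "answers E \<sigma> \<rho> 0 = []"
| "answers E \<sigma> \<rho> (Suc n) =
     answers E \<sigma> \<rho> n @ [map (\<lambda>c. graph_dist E c (\<rho> n)) (\<sigma> (answers E \<sigma> \<rho> n))]"

text \<open>
  The robber is located in round \<open>n\<close> (counted from 0) if every robber play that gives the same
  answers in rounds \<open>0..n\<close> is at the same vertex in round \<open>n\<close>. Quantifying over all plays after
  the strategy is fixed expresses that the robber knows the strategy.
\<close>

definition located :: "'v set \<Rightarrow> 'v rel \<Rightarrow> (nat list list \<Rightarrow> 'v list) \<Rightarrow> (nat \<Rightarrow> 'v) \<Rightarrow> nat \<Rightarrow> bool" where
  "located V E \<sigma> \<rho> n \<longleftrightarrow>
     (\<forall>\<tau>. robber_play V E \<tau> \<and> answers E \<sigma> \<tau> (Suc n) = answers E \<sigma> \<rho> (Suc n) \<longrightarrow> \<tau> n = \<rho> n)"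

definition cops_can_locate :: "'v set \<Rightarrow> 'v rel \<Rightarrow> nat \<Rightarrow> bool" where
  "cops_can_locate V E m \<longleftrightarrow>
     (\<exists>\<sigma>. cop_strategy V m \<sigma> \<and> (\<forall>\<rho>. robber_play V E \<rho> \<longrightarrow> (\<exists>n. located V E \<sigma> \<rho> n)))"

definition localization_number :: "'v set \<Rightarrow> 'v rel \<Rightarrow> nat" where
  "localization_number V E = (LEAST m. cops_can_locate V E m)"

end

theory Submission
  imports Defs
begin

text \<open>
  The robber alternates between points and blocks, and is safe even if the cops learn his exact
  position \<open>x\<close> every other round. Among the \<open>r\<close> blocks through \<open>x\<close>, a single probe singles out at most
  \<open>\<alpha> = min k (r - k)\<close>, so at least \<open>r - d \<alpha> \<ge> 2\<close> of them answer all \<open>d\<close> probes alike. He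
  moves to one of these and then to a point on it; it remains to find two
  points in their union that the next \<open>d\<close> probes do not separate. Say that a probe hits a point if
  it equals or contains it; probes separate points by the sets of probes hitting them. Each
  probe hits at most \<open>k\<close> points, at most one point is unhit and at most \<open>d\<close> points are hit once,
  so separating all of the \<open>(r - d \<alpha>) (k - 1)\<close> points other than \<open>x\<close> would contradict the second bound.
  If \<open>d < k\<close>, two of the blocks suffice.
\<close>

section \<open>Evading and locating in arbitrary graphs\<close>

abbreviation probe :: "'v rel \<Rightarrow> 'v list \<Rightarrow> 'v \<Rightarrow> nat list" where
  "probe E cs w \<equiv> map (\<lambda>c. graph_dist E c w) cs"

lemma answers_cong:
  assumes "\<And>i. i < n \<Longrightarrow> \<rho> i = \<tau> i"
  shows "answers E \<sigma> \<rho> n = answers E \<sigma> \<tau> n"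
  using assms by (induction n) auto

lemma graph_dist_self: "graph_dist E u u = 0"
  unfolding graph_dist_def by (rule Least_eq_0) simp

text \<open>Reachability matters: without any walk the \<open>LEAST\<close> is unspecified and might
  be 0.\<close>

lemma graph_dist_eq_0D:
  assumes "(u, w) \<in> E\<^sup>*" "graph_dist E u w = 0"
  shows "u = w"
proof -
  obtain n where "(u, w) \<in> E ^^ n"
    using assms(1) rtrancl_imp_relpow by blast
  then have "(u, w) \<in> E ^^ graph_dist E u w"
    unfolding graph_dist_def by (rule LeastI)
  then show ?thesis
    using assms(2) by simp
qed

text \<open>Probing every vertex locates the robber in round 0, at the only probe answering 0. This
  guarantees that the \<open>LEAST\<close> in \<open>localization_number\<close> ranges over a
  nonempty set.\<close>

lemma cops_can_locate_card:
  assumes fin: "finite V" and conn: "\<And>u w. u \<in> V \<Longrightarrow> w \<in> V \<Longrightarrow> (u, w) \<in> E\<^sup>*"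
  shows "cops_can_locate V E (card V)"
proof -
  obtain vs where vs: "set vs = V" "distinct vs"
    using fin finite_distinct_list by blast
  have "located V E (\<lambda>_. vs) \<rho> 0" if \<rho>: "robber_play V E \<rho>" for \<rho>
    unfolding located_def
  proof (intro allI impI)
    fix \<tau> assume \<tau>: "robber_play V E \<tau> \<and> answers E (\<lambda>_. vs) \<tau> (Suc 0) = answers E (\<lambda>_. vs) \<rho> (Suc 0)"
    have V: "\<rho> 0 \<in> V" "\<tau> 0 \<in> V"
      using \<rho> \<tau> by (auto simp: robber_play_def)
    have "graph_dist E (\<rho> 0) (\<tau> 0) = graph_dist E (\<rho> 0) (\<rho> 0)"
      using \<tau> V vs by auto
    then show "\<tau> 0 = \<rho> 0"
      using graph_dist_eq_0D[OF conn[OF V]] by (simp add: graph_dist_self)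
  qed
  moreover have "cop_strategy V (card V) (\<lambda>_. vs)"
    using vs by (auto simp: cop_strategy_def distinct_card[symmetric])
  ultimately show ?thesis
    unfolding cops_can_locate_def by blast
qed

text \<open>
  Building the play two rounds at a time, from one point of \<open>P\<close> to the next, means that the
  robber commits to a vertex only after the next two probes are known; no compactness argument is
  needed to obtain the infinite play.
\<close>

lemma evasion:
  assumes P: "x0 \<in> P" "P \<subseteq> V"
    and step: "\<And>x cs. x \<in> P \<Longrightarrow> length cs = m \<Longrightarrow> set cs \<subseteq> V \<Longrightarrow>
      \<exists>T \<subseteq> V. (\<forall>t\<in>T. (x, t) \<in> E) \<and> (\<exists>t\<in>T. \<exists>t'\<in>T. t \<noteq> t')
        \<and> (\<forall>t\<in>T. \<forall>t'\<in>T. probe E cs t = probe E cs t')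
        \<and> (\<forall>cs'. length cs' = m \<longrightarrow> set cs' \<subseteq> V \<longrightarrow>
            (\<exists>p\<in>P. \<exists>q\<in>P. p \<noteq> q \<and> (\<exists>t\<in>T. (t, p) \<in> E) \<and> (\<exists>t\<in>T. (t, q) \<in> E)
              \<and> probe E cs' p = probe E cs' q))"
  shows "\<not> cops_can_locate V E m"
proof
  assume "cops_can_locate V E m"
  then obtain \<sigma> where \<sigma>: "cop_strategy V m \<sigma>"
    and win: "\<And>\<rho>. robber_play V E \<rho> \<Longrightarrow> \<exists>n. located V E \<sigma> \<rho> n"
    unfolding cops_can_locate_def by blast
  have \<sigma>V: "length (\<sigma> h) = m" "set (\<sigma> h) \<subseteq> V" for h
    using \<sigma> by (auto simp: cop_strategy_def)
  \<comment> \<open>The robber moves from \<open>x\<close> through \<open>t\<close> to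
    \<open>p\<close>. The vertex \<open>t'\<close> is his alibi in the first of the two rounds, the
    path through \<open>u\<close> to \<open>q\<close> his alibi in the second; \<open>u\<close> may
    equal \<open>t\<close>.\<close>
  let ?ok = "\<lambda>h x (t, t', u, p, q). {t, t', u} \<subseteq> V \<and> {p, q} \<subseteq> P \<and> t \<noteq> t' \<and> p \<noteq> q
    \<and> (x, t) \<in> E \<and> (x, t') \<in> E \<and> (x, u) \<in> E \<and> (t, p) \<in> E \<and> (u, q) \<in> E
    \<and> probe E (\<sigma> h) t' = probe E (\<sigma> h) t \<and> probe E (\<sigma> h) u = probe E (\<sigma> h) t
    \<and> probe E (\<sigma> (h @ [probe E (\<sigma> h) t])) q = probe E (\<sigma> (h @ [probe E (\<sigma> h) t])) p"
  have ex: "\<exists>w. ?ok h x w" if x: "x \<in> P" for h x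
  proof -
    obtain T where T: "T \<subseteq> V" "\<forall>t\<in>T. (x, t) \<in> E" "\<exists>t\<in>T. \<exists>t'\<in>T. t \<noteq> t'"
      "\<forall>t\<in>T. \<forall>t'\<in>T. probe E (\<sigma> h) t = probe E (\<sigma> h) t'"
      and next_probe: "\<And>cs'. length cs' = m \<Longrightarrow> set cs' \<subseteq> V \<Longrightarrow>
            \<exists>p\<in>P. \<exists>q\<in>P. p \<noteq> q \<and> (\<exists>t\<in>T. (t, p) \<in> E) \<and> (\<exists>t\<in>T. (t, q) \<in> E)
              \<and> probe E cs' p = probe E cs' q"
      using step[OF x \<sigma>V[of h]] by blast
    \<comment> \<open>The second probe depends on the answer to the first, which is the same on all
      of \<open>T\<close>. So any \<open>s\<close> determines that probe before \<open>t\<close> is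
      chosen.\<close>
    obtain s where s: "s \<in> T"
      using T(3) by blast
    obtain p q t u where pq: "p \<in> P" "q \<in> P" "p \<noteq> q" "t \<in> T" "(t, p) \<in> E" "u \<in> T" "(u, q) \<in> E"
      "probe E (\<sigma> (h @ [probe E (\<sigma> h) s])) p = probe E (\<sigma> (h @ [probe E (\<sigma> h) s])) q"
      using next_probe[OF \<sigma>V[of "h @ [probe E (\<sigma> h) s]"]] by blast
    obtain t' where t': "t' \<in> T" "t' \<noteq> t"
      using T(3) by blast
    have same: "probe E (\<sigma> h) w = probe E (\<sigma> h) t" if "w \<in> T" for w
      using T(4) that pq(4) by blast
    have "?ok h x (t, t', u, p, q)"
      using pq(1-7) pq(8)[unfolded same[OF s], symmetric] t' T(1,2) same[OF t'(1)] same[OF pq(6)]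
      by (simp add: subset_iff del: map_eq_conv)
    then show ?thesis ..
  qed
  define w where "w = (\<lambda>h x. SOME w. ?ok h x w)"
  have w: "?ok h x (w h x)" if "x \<in> P" for h x
    unfolding w_def by (rule someI_ex[OF ex[OF that]])
  define t where "t h x = fst (w h x)" for h x
  define t' where "t' h x = fst (snd (w h x))" for h x
  define u where "u h x = fst (snd (snd (w h x)))" for h x
  define p where "p h x = fst (snd (snd (snd (w h x))))" for h x
  define q where "q h x = snd (snd (snd (snd (w h x))))" for h x
  have ok: "t h x \<in> V" "t' h x \<in> V" "u h x \<in> V" "p h x \<in> P" "q h x \<in> P"
    "t h x \<noteq> t' h x" "p h x \<noteq> q h x"
    "(x, t h x) \<in> E" "(x, t' h x) \<in> E" "(x, u h x) \<in> E" "(t h x, p h x) \<in> E" "(u h x, q h x) \<in> E"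
    "probe E (\<sigma> h) (t' h x) = probe E (\<sigma> h) (t h x)"
    "probe E (\<sigma> h) (u h x) = probe E (\<sigma> h) (t h x)"
    "probe E (\<sigma> (h @ [probe E (\<sigma> h) (t h x)])) (q h x)
      = probe E (\<sigma> (h @ [probe E (\<sigma> h) (t h x)])) (p h x)" if "x \<in> P" for h x
    using w[OF that, of h] unfolding t_def t'_def u_def p_def q_def
    by (simp_all add: case_prod_beta)
  \<comment> \<open>After \<open>i\<close> steps the state holds the answers of all rounds before
    \<open>2 * i\<close> and the current element of \<open>P\<close>. The play does not start at
    \<open>x0\<close>: round 0 is already spent at a neighbour of it.\<close>
  define st where "st = rec_nat ([], x0) (\<lambda>_ (h, x).
    let h' = h @ [probe E (\<sigma> h) (t h x)] in (h' @ [probe E (\<sigma> h') (p h x)], p h x))"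
  define h where "h i = fst (st i)" for i
  define x where "x i = snd (st i)" for i
  have st0: "h 0 = []" "x 0 = x0"
    by (simp_all add: h_def x_def st_def)
  have xS: "x (Suc i) = p (h i) (x i)" for i
    by (simp add: h_def x_def st_def Let_def case_prod_beta)
  have hS: "h (Suc i) = (h i @ [probe E (\<sigma> (h i)) (t (h i) (x i))])
     @ [probe E (\<sigma> (h i @ [probe E (\<sigma> (h i)) (t (h i) (x i))])) (x (Suc i))]" for i
    by (simp add: h_def x_def st_def Let_def case_prod_beta)
  have xP: "x i \<in> P" for i
    by (induction i) (auto simp: st0 P(1) xS ok)
  note ok = ok[OF xP]
  define \<rho> where "\<rho> n = (if even n then t (h (n div 2)) (x (n div 2)) else x (Suc (n div 2)))" for n
  have \<rho>_even: "\<rho> (2 * i) = t (h i) (x i)" and \<rho>_odd: "\<rho> (Suc (2 * i)) = x (Suc i)" for i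
    by (simp_all add: \<rho>_def)
  have ans: "answers E \<sigma> \<rho> (2 * i) = h i" for i
    by (induction i) (simp_all add: st0 hS \<rho>_even \<rho>_odd)
  have \<rho>V: "\<rho> n \<in> V" for n
    using P(2) xP ok by (auto simp: \<rho>_def)
  have \<rho>E: "(\<rho> n, \<rho> (Suc n)) \<in> E" for n
  proof (cases "even n")
    case True
    then obtain i where "n = 2 * i" by blast
    then show ?thesis using ok by (simp add: \<rho>_even \<rho>_odd xS)
  next
    case False
    then obtain i where i: "n = Suc (2 * i)" by (auto elim: oddE)
    have "\<rho> (Suc (Suc (2 * i))) = t (h (Suc i)) (x (Suc i))"
      using \<rho>_even[of "Suc i"] by simp
    then show ?thesis using ok i by (simp add: \<rho>_odd)
  qed
  obtain n where loc: "located V E \<sigma> \<rho> n"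
    using win[of \<rho>] \<rho>V \<rho>E by (auto simp: robber_play_def)
  define i where "i = n div 2"
  \<comment> \<open>The rival play for round \<open>n\<close>: follow \<rho> before round
    \<open>2 * i\<close>, then detour to \<open>t'\<close> if \<open>n\<close> is even, or through
    \<open>u\<close> to \<open>q\<close> if \<open>n\<close> is odd, and stay there forever.\<close>
  define \<tau> where "\<tau> j = (if j < 2 * i then \<rho> j else if odd n then
    if j = 2 * i then u (h i) (x i) else q (h i) (x i) else t' (h i) (x i))" for j
  have "answers E \<sigma> \<tau> (2 * i) = answers E \<sigma> \<rho> (2 * i)"
    by (rule answers_cong) (simp add: \<tau>_def)
  then have ans\<tau>: "answers E \<sigma> \<tau> (2 * i) = h i"
    by (simp add: ans)
  \<comment> \<open>For positive \<open>i\<close>, \<rho> occupies \<open>x i\<close> in round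
    \<open>2 * i - 1\<close>, so the detour can branch off there. For \<open>i = 0\<close> no round
    precedes it and the rival play starts on the detour.\<close>
  have enter: "(\<rho> j, s) \<in> E" if s: "(x i, s) \<in> E" "Suc j = 2 * i" for j s
  proof -
    obtain i' where "i = Suc i'"
      using s(2) by (cases i) auto
    then show ?thesis
      using s \<rho>_odd[of i'] by simp
  qed
  have "robber_play V E \<tau>"
    unfolding robber_play_def
  proof (intro conjI allI)
    fix j
    show "\<tau> j \<in> V"
      using \<rho>V ok P(2) by (auto simp: \<tau>_def)
    consider "Suc j < 2 * i" | "Suc j = 2 * i" | "j \<ge> 2 * i"
      by linarith
    then show "\<tau> (Suc j) = \<tau> j \<or> (\<tau> j, \<tau> (Suc j)) \<in> E"
    proof cases
      case 1
      then show ?thesis using \<rho>E by (simp add: \<tau>_def)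
    next
      case 2
      then show ?thesis using enter ok by (auto simp: \<tau>_def)
    next
      case 3
      then show ?thesis using ok by (auto simp: \<tau>_def)
    qed
  qed
  moreover have "answers E \<sigma> \<tau> (Suc n) = answers E \<sigma> \<rho> (Suc n) \<and> \<tau> n \<noteq> \<rho> n"
  proof (cases "even n")
    case True
    then have "n = 2 * i" by (simp add: i_def)
    then show ?thesis
      using ok(6,13)[of "h i" i] by (auto simp: ans ans\<tau> \<rho>_even \<tau>_def)
  next
    case False
    then have n: "n = Suc (2 * i)" by (simp add: i_def)
    have "\<tau> (2 * i) = u (h i) (x i)" "\<tau> n = q (h i) (x i)"
      using n by (auto simp: \<tau>_def)
    then show ?thesis
      using ok(7,14,15)[of "h i" i]
      by (simp add: n ans ans\<tau> \<rho>_even \<rho>_odd xS del: map_eq_conv)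
  qed
  ultimately show False
    using loc unfolding located_def by blast
qed

section \<open>Counting hits\<close>

text \<open>If all points had different sets of hitting probes, the empty set and each singleton
  would occur at most once, while every other point uses up at least two of the at most
  \<open>card C * k\<close> hits.\<close>

lemma signature_collision_count:
  fixes hit :: "'c \<Rightarrow> 'p \<Rightarrow> bool"
  assumes fin: "finite C" "finite Y"
    and few: "\<And>c. c \<in> C \<Longrightarrow> card {p \<in> Y. hit c p} \<le> k"
    and big: "card C * (k + 1) + 2 < 2 * card Y"
  shows "\<exists>p\<in>Y. \<exists>q\<in>Y. p \<noteq> q \<and> (\<forall>c\<in>C. hit c p \<longleftrightarrow> hit c q)"
proof (rule ccontr)
  assume neg: "\<not> ?thesis"
  define sig where "sig p = {c \<in> C. hit c p}" for p
  have inj: "inj_on sig Y"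
  proof (rule inj_onI)
    fix p q assume *: "p \<in> Y" "q \<in> Y" "sig p = sig q"
    then have "\<forall>c\<in>C. hit c p \<longleftrightarrow> hit c q"
      by (auto simp: sig_def)
    with neg * show "p = q" by blast
  qed
  have fsig: "finite (sig p)" for p
    using fin by (simp add: sig_def)
  let ?Y0 = "{p \<in> Y. sig p = {}}" and ?Y1 = "{p \<in> Y. card (sig p) = 1}"
  have "card ?Y0 \<le> card {{} :: 'c set}"
    by (rule card_inj_on_le[of sig]) (auto intro: inj_on_subset[OF inj])
  then have Y0: "card ?Y0 \<le> 1" by simp
  have "card ?Y1 \<le> card ((\<lambda>c. {c}) ` C)"
  proof (rule card_inj_on_le[of sig])
    show "sig ` ?Y1 \<subseteq> (\<lambda>c. {c}) ` C"
      by (auto simp: card_1_singleton_iff) (auto simp: sig_def)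
  qed (auto intro: inj_on_subset[OF inj] simp: fin)
  also have "\<dots> \<le> card C"
    by (rule card_image_le[OF fin(1)])
  finally have Y1: "card ?Y1 \<le> card C" .
  have "(\<Sum>p\<in>Y. card (sig p)) = (\<Sum>p\<in>Y. \<Sum>c\<in>C. if hit c p then 1 else 0)"
    using fin by (simp add: sig_def sum.If_cases Int_def)
  also have "\<dots> = (\<Sum>c\<in>C. card {p \<in> Y. hit c p})"
    using fin by (subst sum.swap) (simp add: sum.If_cases Int_def)
  also have "\<dots> \<le> card C * k"
    using sum_bounded_above[OF few] by simp
  finally have hits: "(\<Sum>p\<in>Y. card (sig p)) \<le> card C * k" .
  have "2 * card Y = (\<Sum>p\<in>Y. 2)"
    by simp
  \<comment> \<open>Each point is topped up to at least 2: an unhit point receives 2 and a point hit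
    once receives 1 beyond its hits. The supplements total at most
    \<open>card C + 2\<close>.\<close>
  also have "\<dots> \<le> (\<Sum>p\<in>Y. card (sig p) + (if card (sig p) = 1 then 1 else 0)
      + (if sig p = {} then 2 else 0))"
  proof (rule sum_mono)
    fix p
    have "sig p = {} \<or> card (sig p) \<ge> 1"
      using fsig[of p] by (simp add: Suc_le_eq card_gt_0_iff)
    then show "2 \<le> card (sig p) + (if card (sig p) = 1 then 1 else 0) + (if sig p = {} then 2 else 0)"
      by auto
  qed
  also have "\<dots> = (\<Sum>p\<in>Y. card (sig p)) + card ?Y1 + 2 * card ?Y0"
    using fin by (simp add: sum.distrib sum.If_cases Int_def)
  finally show False
    using hits Y0 Y1 big by simp
qed

text \<open>Choosing a hitting probe for each point is injective by \<open>once\<close>, hence a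
  bijection onto \<open>C\<close> by \<open>le\<close>. Each probe has then spent its only hit on
  its own point, so no point is hit by a second probe.\<close>

lemma signature_singleton:
  fixes hit :: "'c \<Rightarrow> 'p \<Rightarrow> bool"
  assumes fin: "finite C" "finite A" and le: "card C \<le> card A"
    and hits: "\<And>a. a \<in> A \<Longrightarrow> \<exists>c\<in>C. hit c a"
    and once: "\<And>c a a'. c \<in> C \<Longrightarrow> a \<in> A \<Longrightarrow> a' \<in> A \<Longrightarrow> hit c a \<Longrightarrow> hit c a' \<Longrightarrow> a = a'"
    and c: "c \<in> C"
  shows "\<exists>a\<in>A. \<forall>c'\<in>C. hit c' a \<longleftrightarrow> c' = c"
proof -
  obtain f where f: "\<And>a. a \<in> A \<Longrightarrow> f a \<in> C \<and> hit (f a) a"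
    using hits by metis
  have inj: "inj_on f A"
    by (rule inj_onI) (metis f once)
  have "f ` A = C"
    using fin f le by (intro card_subset_eq) (auto simp: card_image[OF inj] intro!: antisym
        card_inj_on_le[OF inj])
  then show ?thesis
    using c f once by (smt (verit) image_iff)
qed

text \<open>Each hit point occupies a probe of its own, so at most \<open>card C\<close> points of
  \<open>A\<close> are hit.\<close>

lemma two_unhit:
  fixes hit :: "'c \<Rightarrow> 'p \<Rightarrow> bool"
  assumes fin: "finite C" "finite A" and le: "card C + 2 \<le> card A"
    and once: "\<And>c a a'. c \<in> C \<Longrightarrow> a \<in> A \<Longrightarrow> a' \<in> A \<Longrightarrow> hit c a \<Longrightarrow> hit c a' \<Longrightarrow> a = a'"
  shows "\<exists>p\<in>A. \<exists>q\<in>A. p \<noteq> q \<and> (\<forall>c\<in>C. \<not> hit c p \<and> \<not> hit c q)"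
proof -
  define H where "H = {a \<in> A. \<exists>c\<in>C. hit c a}"
  have "\<forall>a\<in>H. \<exists>c. c \<in> C \<and> hit c a"
    by (auto simp: H_def)
  then obtain f where f: "\<And>a. a \<in> H \<Longrightarrow> f a \<in> C \<and> hit (f a) a"
    by metis
  have "H \<subseteq> A"
    by (auto simp: H_def)
  have "inj_on f H"
    by (rule inj_onI) (metis f once subsetD[OF \<open>H \<subseteq> A\<close>])
  then have "card H \<le> card C"
    using f fin by (intro card_inj_on_le) auto
  moreover have "card (A - H) = card A - card H"
    using fin by (intro card_Diff_subset) (auto simp: H_def)
  ultimately have "2 \<le> card (A - H)"
    using le by simp
  then obtain p q where "p \<in> A - H" "q \<in> A - H" "p \<noteq> q"
    by (metis card_2_iff' card_le_Suc0_iff_eq fin(2) finite_Diff not_less_eq_eq numeral_2_eq_2)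
  then show ?thesis
    unfolding H_def by blast
qed

section \<open>Designs with \<open>\<lambda> = 1\<close>\<close>

locale linear_design =
  fixes X :: "'a set" and \<B> :: "'a set set" and v b r k :: nat
  assumes bibd: "bibd X \<B> v b r k 1" and k_less_r: "k < r"
begin

abbreviation "V \<equiv> incidence_verts X \<B>"
abbreviation "E \<equiv> incidence_adj X \<B>"
abbreviation "pencil x \<equiv> {B \<in> \<B>. x \<in> B}"

lemma finite_points: "finite X" and points_nonempty: "X \<noteq> {}"
  and block_subset: "B \<in> \<B> \<Longrightarrow> B \<subseteq> X"
  and card_block: "B \<in> \<B> \<Longrightarrow> card B = k"
  and card_pencil: "x \<in> X \<Longrightarrow> card (pencil x) = r"
  and card_joining: "x \<in> X \<Longrightarrow> y \<in> X \<Longrightarrow> x \<noteq> y \<Longrightarrow> card {B \<in> \<B>. x \<in> B \<and> y \<in> B} = 1"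
  using bibd by (auto simp: bibd_def)

lemma finite_blocks: "finite \<B>"
  using finite_points block_subset by (meson Pow_iff finite_Pow_iff finite_subset subsetI)

lemma finite_block: "B \<in> \<B> \<Longrightarrow> finite B"
  using finite_points block_subset finite_subset by blast

lemma finite_subpencil: "T \<subseteq> pencil x \<Longrightarrow> finite T"
  using finite_blocks by (auto intro: finite_subset)

lemma joining_block_ex:
  assumes "x \<in> X" "y \<in> X" "x \<noteq> y"
  shows "\<exists>B\<in>\<B>. x \<in> B \<and> y \<in> B"
  using card_joining[OF assms] by (auto simp: card_1_singleton_iff)

lemma joining_block_unique:
  assumes "x \<noteq> y" "B \<in> \<B>" "x \<in> B" "y \<in> B" "D \<in> \<B>" "x \<in> D" "y \<in> D"
  shows "B = D"
proof -
  have "x \<in> X" "y \<in> X"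
    using assms block_subset by blast+
  then obtain C where C: "{B \<in> \<B>. x \<in> B \<and> y \<in> B} = {C}"
    using card_joining[of x y] assms(1) card_1_singletonE by blast
  have "B \<in> {C}" "D \<in> {C}"
    unfolding C[symmetric] using assms by simp_all
  then show ?thesis by simp
qed

text \<open>With \<open>k\<close> at most 1, the only possible block through \<open>x\<close> is
  \<open>{x}\<close>, so \<open>r\<close> is at most 1 and \<open>k < r\<close> forces
  \<open>k = 0\<close>. Then no block contains \<open>x\<close>, so \<open>r = 0\<close>, a
  contradiction.\<close>

lemma k_ge_2: "2 \<le> k"
proof (rule ccontr)
  assume "\<not> 2 \<le> k"
  obtain x where x: "x \<in> X"
    using points_nonempty by blast
  have "pencil x \<subseteq> {{x}}"
  proof
    fix B assume B: "B \<in> pencil x"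
    then have "card B \<le> Suc 0" "finite B"
      using \<open>\<not> 2 \<le> k\<close> card_block finite_block by auto
    then show "B \<in> {{x}}"
      using B by (auto simp: card_le_Suc0_iff_eq)
  qed
  then have r: "r \<le> 1"
    using card_pencil[OF x] card_mono[of "{{x}}" "pencil x"] by simp
  then have "k = 0"
    using k_less_r by simp
  then have "pencil x = {}"
    using card_block finite_block by fastforce
  then show False
    using card_pencil[OF x] k_less_r by (metis card.empty not_less0)
qed

lemma pencil_ex: "x \<in> X \<Longrightarrow> \<exists>B\<in>\<B>. x \<in> B"
  using card_pencil[of x] k_less_r by (metis (mono_tags, lifting) card.empty empty_Collect_eq not_less0)

lemma joining_ex: "x \<in> X \<Longrightarrow> y \<in> X \<Longrightarrow> \<exists>B\<in>\<B>. x \<in> B \<and> y \<in> B"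
  using joining_block_ex pencil_ex by (cases "x = y") auto

lemma block_nonempty: "B \<in> \<B> \<Longrightarrow> B \<noteq> {}"
  using card_block k_ge_2 by fastforce

section \<open>Walks and distances in the incidence graph\<close>

lemma adj_simps [simp]:
  "(Inl x, Inl y) \<notin> E" "(Inr B, Inr D) \<notin> E"
  "(Inl x, Inr B) \<in> E \<longleftrightarrow> B \<in> \<B> \<and> x \<in> B"
  "(Inr B, Inl x) \<in> E \<longleftrightarrow> B \<in> \<B> \<and> x \<in> B"
  using block_subset by (auto simp: incidence_adj_def)

lemma verts_simps [simp]: "Inl x \<in> V \<longleftrightarrow> x \<in> X" "Inr B \<in> V \<longleftrightarrow> B \<in> \<B>"
  by (auto simp: incidence_verts_def)

text \<open>Distances are least walk lengths, so walks of length 2 and 3 are described exactly in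
  order to exclude shorter ones. Walks may backtrack, so the end points may coincide here.\<close>

lemma walk2: "(Inl x, Inl y) \<in> E ^^ 2 \<longleftrightarrow> (\<exists>B\<in>\<B>. x \<in> B \<and> y \<in> B)"
  "(Inl x, Inr B) \<notin> E ^^ 2" "(Inr B, Inl x) \<notin> E ^^ 2"
  "(Inr B, Inr D) \<in> E ^^ 2 \<longleftrightarrow> B \<in> \<B> \<and> D \<in> \<B> \<and> B \<inter> D \<noteq> {}"
  by (auto simp: numeral_2_eq_2 relcomp_unfold split_sum_ex)

lemma walk3: "(Inr B, Inr D) \<notin> E ^^ 3"
  "(Inl x, Inr B) \<in> E ^^ 3 \<longleftrightarrow> B \<in> \<B> \<and> (\<exists>y\<in>B. \<exists>D\<in>\<B>. x \<in> D \<and> y \<in> D)"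
  "(Inr B, Inl x) \<in> E ^^ 3 \<longleftrightarrow> B \<in> \<B> \<and> (\<exists>y\<in>B. \<exists>D\<in>\<B>. x \<in> D \<and> y \<in> D)"
proof -
  have "E ^^ 3 = E ^^ 2 O E"
    by (simp add: eval_nat_numeral)
  then show "(Inr B, Inr D) \<notin> E ^^ 3"
    "(Inl x, Inr B) \<in> E ^^ 3 \<longleftrightarrow> B \<in> \<B> \<and> (\<exists>y\<in>B. \<exists>D\<in>\<B>. x \<in> D \<and> y \<in> D)"
    "(Inr B, Inl x) \<in> E ^^ 3 \<longleftrightarrow> B \<in> \<B> \<and> (\<exists>y\<in>B. \<exists>D\<in>\<B>. x \<in> D \<and> y \<in> D)"
    by (auto simp: relcomp_unfold split_sum_ex walk2)
qed

lemma walk4: "B \<in> \<B> \<Longrightarrow> D \<in> \<B> \<Longrightarrow> (Inr B, Inr D) \<in> E ^^ 4"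
proof -
  assume BD: "B \<in> \<B>" "D \<in> \<B>"
  obtain x where x: "x \<in> B" "x \<in> X"
    using block_nonempty[OF BD(1)] block_subset[OF BD(1)] by blast
  obtain y where y: "y \<in> D" "y \<in> X"
    using block_nonempty[OF BD(2)] block_subset[OF BD(2)] by blast
  obtain C where C: "C \<in> \<B>" "x \<in> C" "y \<in> C"
    using joining_ex[OF x(2) y(2)] by blast
  then have "(Inr B, Inr C) \<in> E ^^ 2" "(Inr C, Inr D) \<in> E ^^ 2"
    using BD x y by (auto simp: walk2)
  then have "(Inr B, Inr D) \<in> E ^^ (2 + 2)"
    unfolding relpow_add by blast
  then show ?thesis by simp
qed

lemma dist_point_point:
  assumes "x \<in> X" "y \<in> X" "x \<noteq> y"
  shows "graph_dist E (Inl x) (Inl y) = 2"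
  unfolding graph_dist_def
proof (rule Least_equality)
  show "(Inl x, Inl y) \<in> E ^^ 2"
    using joining_ex assms by (simp add: walk2)
next
  fix n assume n: "(Inl x, Inl y) \<in> E ^^ n"
  show "2 \<le> n"
  proof (rule ccontr)
    assume "\<not> 2 \<le> n"
    then have "n = 0 \<or> n = 1" by auto
    then show False using n assms by auto
  qed
qed

lemma dist_point_block:
  assumes "x \<in> X" "B \<in> \<B>"
  shows "graph_dist E (Inl x) (Inr B) = (if x \<in> B then 1 else 3)"
  unfolding graph_dist_def
proof (rule Least_equality)
  show "(Inl x, Inr B) \<in> E ^^ (if x \<in> B then 1 else 3)"
    using assms block_nonempty[of B] block_subset[of B] joining_ex[of x]
    by (auto simp: walk3 relpow_1)
next
  fix n assume n: "(Inl x, Inr B) \<in> E ^^ n"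
  show "(if x \<in> B then 1 else 3) \<le> n"
  proof (rule ccontr)
    assume less: "\<not> ?thesis"
    then have "n = 0 \<or> n = 1 \<or> n = 2" by (auto split: if_splits)
    then show False
      by (elim disjE) (use n less in \<open>auto simp: walk2 split: if_splits\<close>)
  qed
qed

lemma dist_block_point:
  assumes "x \<in> X" "B \<in> \<B>"
  shows "graph_dist E (Inr B) (Inl x) = (if x \<in> B then 1 else 3)"
  unfolding graph_dist_def
proof (rule Least_equality)
  show "(Inr B, Inl x) \<in> E ^^ (if x \<in> B then 1 else 3)"
    using assms block_nonempty[of B] block_subset[of B] joining_ex[of x]
    by (auto simp: walk3 relpow_1)
next
  fix n assume n: "(Inr B, Inl x) \<in> E ^^ n"
  show "(if x \<in> B then 1 else 3) \<le> n"
  proof (rule ccontr)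
    assume less: "\<not> ?thesis"
    then have "n = 0 \<or> n = 1 \<or> n = 2" by (auto split: if_splits)
    then show False
      by (elim disjE) (use n less in \<open>auto simp: walk2 split: if_splits\<close>)
  qed
qed

lemma dist_block_block:
  assumes "B \<in> \<B>" "D \<in> \<B>" "B \<noteq> D"
  shows "graph_dist E (Inr B) (Inr D) = (if B \<inter> D \<noteq> {} then 2 else 4)"
  unfolding graph_dist_def
proof (rule Least_equality)
  show "(Inr B, Inr D) \<in> E ^^ (if B \<inter> D \<noteq> {} then 2 else 4)"
    using assms by (auto simp: walk2 walk4)
next
  fix n assume n: "(Inr B, Inr D) \<in> E ^^ n"
  show "(if B \<inter> D \<noteq> {} then 2 else 4) \<le> n"
  proof (rule ccontr)
    assume less: "\<not> ?thesis"
    then have "n = 0 \<or> n = 1 \<or> n = 2 \<or> n = 3" by (auto split: if_splits)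
    then show False using n less assms by (auto simp: walk2 walk3 split: if_splits)
  qed
qed

lemma connected:
  assumes "u \<in> V" "w \<in> V"
  shows "(u, w) \<in> E\<^sup>*"
proof -
  obtain x where x: "x \<in> X" using points_nonempty by blast
  have ex: "\<exists>n. (Inl x, w) \<in> E ^^ n \<and> (w, Inl x) \<in> E ^^ n" if w: "w \<in> V" for w
  proof (cases w)
    case (Inl y)
    then show ?thesis
      using joining_ex[of x y] x w by (intro exI[of _ 2]) (auto simp: walk2)
  next
    case (Inr B)
    then have B: "B \<in> \<B>" using w by simp
    then obtain y where y: "y \<in> B" "y \<in> X"
      using block_nonempty block_subset by blast
    then show ?thesis
      using joining_ex[OF x y(2)] B Inr by (intro exI[of _ 3]) (auto simp: walk3)
  qed
  have "(u, Inl x) \<in> E\<^sup>*" "(Inl x, w) \<in> E\<^sup>*"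
    using ex[OF assms(1)] ex[OF assms(2)] relpow_imp_rtrancl by blast+
  then show ?thesis by simp
qed

section \<open>What probes reveal about the blocks through a point\<close>

lemma card_meeting_pencil:
  assumes "x \<in> X" "D \<in> \<B>" "x \<notin> D"
  shows "card {B \<in> pencil x. B \<inter> D \<noteq> {}} = k"
proof -
  obtain f where f: "\<And>y. y \<in> D \<Longrightarrow> f y \<in> \<B> \<and> x \<in> f y \<and> y \<in> f y"
    using joining_ex[OF assms(1)] block_subset[OF assms(2)] by (metis subsetD)
  \<comment> \<open>A block joining \<open>x\<close> to two points of \<open>D\<close> would be
    \<open>D\<close> itself, which misses \<open>x\<close>.\<close>
  have "inj_on f D"
    by (rule inj_onI) (metis f assms joining_block_unique)
  moreover have "f ` D = {B \<in> pencil x. B \<inter> D \<noteq> {}}"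
  proof
    show "{B \<in> pencil x. B \<inter> D \<noteq> {}} \<subseteq> f ` D"
    proof
      fix B assume "B \<in> {B \<in> pencil x. B \<inter> D \<noteq> {}}"
      then obtain y where y: "B \<in> \<B>" "x \<in> B" "y \<in> B" "y \<in> D" by blast
      then have "B = f y"
        using f[of y] assms(3) by (intro joining_block_unique[of x y]) auto
      then show "B \<in> f ` D" using y by blast
    qed
  qed (use f in blast)
  ultimately show ?thesis
    using card_image card_block[OF assms(2)] by metis
qed

text \<open>
  The exceptional set is the smaller side of the split of the pencil caused by a single probe; for a
  block \<open>D\<close> missing \<open>x\<close> the two sides have sizes \<open>k\<close> and \<open>r - k\<close>.
\<close>

lemma single_probe_pencil:
  assumes x: "x \<in> X" and c: "c \<in> V"
  shows "\<exists>S \<subseteq> pencil x. card S \<le> min k (r - k) \<and>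
    (\<forall>B\<in>pencil x - S. \<forall>B'\<in>pencil x - S. graph_dist E c (Inr B) = graph_dist E c (Inr B'))"
proof -
  \<comment> \<open>This leaves room for a one-block exceptional set: the block joining
    \<open>x\<close> to a probed point \<open>y\<close> other than \<open>x\<close>, or a probed
    block \<open>D\<close> through \<open>x\<close>.\<close>
  have pos: "1 \<le> min k (r - k)"
    using k_ge_2 k_less_r by simp
  show ?thesis
  proof (cases c)
    case (Inl y)
    then have y: "y \<in> X" using c by simp
    show ?thesis
    proof (cases "y = x")
      case True
      then show ?thesis
        using Inl x by (intro exI[of _ "{}"]) (auto simp: dist_point_block)
    next
      case False
      then show ?thesis
        using Inl y card_joining[OF x y] pos
        by (intro exI[of _ "{B \<in> \<B>. x \<in> B \<and> y \<in> B}"]) (auto simp: dist_point_block)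
    qed
  next
    case (Inr D)
    then have D: "D \<in> \<B>" using c by simp
    show ?thesis
    proof (cases "x \<in> D")
      case True
      then have "graph_dist E c (Inr B) = 2" if "B \<in> pencil x - {D}" for B
        using that Inr D dist_block_block[of D B]
        by (metis (lifting) DiffE IntI emptyE insertCI mem_Collect_eq)
      then show ?thesis
        using Inr D pos True by (intro exI[of _ "{D}"]) auto
    next
      case False
      let ?M = "{B \<in> pencil x. B \<inter> D \<noteq> {}}"
      have M: "card ?M = k"
        by (rule card_meeting_pencil[OF x D False])
      have fM: "finite ?M" using finite_blocks by simp
      have M': "card (pencil x - ?M) = r - k"
        using M card_pencil[OF x] card_Diff_subset[OF fM, of "pencil x"] by auto
      have dist: "graph_dist E c (Inr B) = (if B \<in> ?M then 2 else 4)" if "B \<in> pencil x" for B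
      proof -
        have "D \<noteq> B" using that False by blast
        then show ?thesis
          using that Inr D dist_block_block[of D B] by (auto simp: Int_commute)
      qed
      show ?thesis
      proof (cases "k \<le> r - k")
        case True
        then show ?thesis
          using M dist by (intro exI[of _ ?M]) auto
      next
        case False
        then show ?thesis
          using M' dist by (intro exI[of _ "pencil x - ?M"]) auto
      qed
    qed
  qed
qed

text \<open>Discarding the exceptional sets of all probes costs at most \<open>min k (r - k)\<close>
  blocks per probe, and every probe is constant on the blocks that remain.\<close>

lemma probe_pencil:
  assumes x: "x \<in> X" and cs: "set cs \<subseteq> V" "length cs \<le> d"
  shows "\<exists>T \<subseteq> pencil x. r - d * min k (r - k) \<le> card T \<and>
    (\<forall>B\<in>T. \<forall>B'\<in>T. probe E cs (Inr B) = probe E cs (Inr B'))"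
proof -
  define small where "small c S \<longleftrightarrow> S \<subseteq> pencil x \<and> card S \<le> min k (r - k) \<and>
    (\<forall>B\<in>pencil x - S. \<forall>B'\<in>pencil x - S. graph_dist E c (Inr B) = graph_dist E c (Inr B'))" for c S
  have "\<forall>c\<in>set cs. \<exists>S. small c S"
    using single_probe_pencil[OF x] cs(1) by (auto simp: small_def)
  then obtain S where small: "\<forall>c\<in>set cs. small c (S c)"
    by metis
  have S: "S c \<subseteq> pencil x" "card (S c) \<le> min k (r - k)"
    "B \<in> pencil x - S c \<Longrightarrow> B' \<in> pencil x - S c \<Longrightarrow> graph_dist E c (Inr B) = graph_dist E c (Inr B')"
    if "c \<in> set cs" for c B B'
    using bspec[OF small that] unfolding small_def by blast+
  let ?U = "\<Union>c\<in>set cs. S c"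
  have "card ?U \<le> (\<Sum>c\<in>set cs. card (S c))"
    by (rule card_UN_le) simp
  also have "\<dots> \<le> card (set cs) * min k (r - k)"
    using sum_bounded_above[of "set cs" "\<lambda>c. card (S c)" "min k (r - k)"] S by simp
  also have "\<dots> \<le> d * min k (r - k)"
    using cs(2) card_length[of cs] by (intro mult_right_mono) auto
  finally have U: "card ?U \<le> d * min k (r - k)" .
  have "?U \<subseteq> pencil x" using S by blast
  then have "card (pencil x - ?U) = r - card ?U"
    using card_pencil[OF x] by (simp add: card_Diff_subset finite_subpencil)
  then have large: "r - d * min k (r - k) \<le> card (pencil x - ?U)"
    using U by simp
  have same: "probe E cs (Inr B) = probe E cs (Inr B')"
    if "B \<in> pencil x - ?U" "B' \<in> pencil x - ?U" for B B'
    using that S by (auto simp: map_eq_conv)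
  show ?thesis
    by (intro exI[of _ "pencil x - ?U"] conjI ballI Diff_subset large same)
qed

section \<open>What probes reveal about points\<close>

primrec hit :: "'a + 'a set \<Rightarrow> 'a \<Rightarrow> bool" where
  "hit (Inl y) p \<longleftrightarrow> p = y"
| "hit (Inr D) p \<longleftrightarrow> p \<in> D"

text \<open>About a point, a probed point answers 0 or 2 and a probed block 1 or 3, so being hit or
  not is all that a probe tells.\<close>

lemma probe_eqI:
  assumes "set cs \<subseteq> V" "p \<in> X" "q \<in> X" "\<And>c. c \<in> set cs \<Longrightarrow> hit c p \<longleftrightarrow> hit c q"
  shows "probe E cs (Inl p) = probe E cs (Inl q)"
proof -
  have "graph_dist E c (Inl p) = graph_dist E c (Inl q)" if c: "c \<in> set cs" for c
    using assms(1,2,3) assms(4)[OF c] c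
    by (cases c; cases "p = q") (auto simp: dist_point_point dist_block_point)
  then show ?thesis by simp
qed

text \<open>Two distinct blocks share at most one point; this supplies the hypothesis
  \<open>once\<close> of the counting lemmas.\<close>

lemma hit_block_once:
  assumes "c \<in> V" "B \<in> \<B>" "c \<noteq> Inr B" "p \<in> B" "q \<in> B" "hit c p" "hit c q"
  shows "p = q"
proof (cases c)
  case (Inl y)
  then show ?thesis using assms by simp
next
  case (Inr D)
  then have "D \<in> \<B>" "D \<noteq> B" "p \<in> D" "q \<in> D" using assms by auto
  then show ?thesis using joining_block_unique assms(2,4,5) by metis
qed

lemma card_hit: "c \<in> V \<Longrightarrow> card {p \<in> Y. hit c p} \<le> k"
proof (cases c)
  case (Inl y)
  have "card {p \<in> Y. hit c p} \<le> card {y}"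
    by (rule card_mono) (auto simp: Inl)
  then show ?thesis using k_ge_2 by simp
next
  case (Inr D)
  assume "c \<in> V"
  then have D: "D \<in> \<B>" using Inr by simp
  have "card {p \<in> Y. hit c p} \<le> card D"
    by (rule card_mono) (auto simp: Inr finite_block D)
  then show ?thesis by (simp add: card_block D)
qed

section \<open>Points on the remaining blocks that the next probes do not separate\<close>

lemma card_Union_pencil:
  assumes x: "x \<in> X" and T: "T \<subseteq> pencil x"
  shows "card (\<Union>T - {x}) = card T * (k - 1)"
proof -
  have eq: "(\<Union>B\<in>T. B - {x}) = \<Union>T - {x}"
    by auto
  have "card (\<Union>B\<in>T. B - {x}) = (\<Sum>B\<in>T. card (B - {x}))"
  proof (rule card_UN_disjoint)
    show "finite T" using T by (rule finite_subpencil)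
    show "\<forall>B\<in>T. finite (B - {x})" using T finite_block by auto
    show "\<forall>B\<in>T. \<forall>D\<in>T. B \<noteq> D \<longrightarrow> (B - {x}) \<inter> (D - {x}) = {}"
    proof (intro ballI impI)
      fix B D assume BD: "B \<in> T" "D \<in> T" "B \<noteq> D"
      show "(B - {x}) \<inter> (D - {x}) = {}"
      proof (rule equals0I)
        fix y assume "y \<in> (B - {x}) \<inter> (D - {x})"
        then show False
          using BD T joining_block_unique[of x y B D] by auto
      qed
    qed
  qed
  also have "\<dots> = (\<Sum>B\<in>T. k - 1)"
    using T card_block by (intro sum.cong) auto
  finally show ?thesis
    by (simp add: eq)
qed

text \<open>Away from \<open>x\<close> the blocks of \<open>T\<close> are disjoint, so each
  contributes \<open>k - 1\<close> points to the count.\<close>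

lemma collision_by_counting:
  assumes x: "x \<in> X" and T: "T \<subseteq> pencil x" and cs: "set cs \<subseteq> V" "length cs \<le> d"
    and big: "d * (k + 1) + 2 < 2 * (card T * (k - 1))"
  shows "\<exists>p\<in>\<Union>T. \<exists>q\<in>\<Union>T. p \<noteq> q \<and> (\<forall>c\<in>set cs. hit c p \<longleftrightarrow> hit c q)"
proof -
  have "finite (\<Union>T - {x})"
    using T finite_block finite_subpencil[OF T] by auto
  moreover have "card (set cs) * (k + 1) \<le> d * (k + 1)"
    using cs(2) card_length[of cs] by (intro mult_right_mono) auto
  ultimately have "\<exists>p\<in>\<Union>T - {x}. \<exists>q\<in>\<Union>T - {x}. p \<noteq> q \<and> (\<forall>c\<in>set cs. hit c p \<longleftrightarrow> hit c q)"
    using big card_Union_pencil[OF x T] card_hit[OF subsetD[OF cs(1)]]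
    by (intro signature_collision_count[where k = k]) (simp_all del: Diff_iff Union_iff)
  then show ?thesis by blast
qed

text \<open>
  If neither \<open>B1\<close> nor \<open>B2\<close> is probed and all points other than \<open>x\<close> are hit, then \<open>card C = k - 1\<close> and
  every probe hits exactly one point of each block, and this point is hit by no other probe.
\<close>

lemma collision_on_two_blocks:
  assumes B: "B1 \<in> pencil x" "B2 \<in> pencil x" "B1 \<noteq> B2"
    and C: "C \<subseteq> V" "finite C" "card C < k"
  shows "\<exists>p\<in>B1 \<union> B2. \<exists>q\<in>B1 \<union> B2. p \<noteq> q \<and> (\<forall>c\<in>C. hit c p \<longleftrightarrow> hit c q)"
proof -
  have own: "\<exists>p\<in>D. \<exists>q\<in>D. p \<noteq> q \<and> (\<forall>c\<in>C. hit c p \<longleftrightarrow> hit c q)" if D: "D \<in> \<B>" "Inr D \<in> C" for D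
  proof -
    \<comment> \<open>A probe at \<open>D\<close> hits all points of \<open>D\<close> and separates
      none of them; the at most \<open>k - 2\<close> other probes hit at most one point of
      \<open>D\<close> each.\<close>
    have "\<exists>p\<in>D. \<exists>q\<in>D. p \<noteq> q \<and> (\<forall>c\<in>C - {Inr D}. \<not> hit c p \<and> \<not> hit c q)"
    proof (rule two_unhit)
      show "card (C - {Inr D}) + 2 \<le> card D"
        using C D by (simp add: card_block)
           (metis Suc_leI Suc_pred card_gt_0_iff empty_iff)
    qed (use C D finite_block hit_block_once[of _ D] in auto)
    then obtain p q where pq: "p \<in> D" "q \<in> D" "p \<noteq> q" "\<forall>c\<in>C - {Inr D}. \<not> hit c p \<and> \<not> hit c q"
      by blast
    then have "\<forall>c\<in>C. hit c p \<longleftrightarrow> hit c q"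
      by (metis Diff_iff empty_iff hit.simps(2) insert_iff)
    with pq show ?thesis by blast
  qed
  show ?thesis
  proof (cases "Inr B1 \<in> C \<or> Inr B2 \<in> C")
    case True
    then show ?thesis using own[of B1] own[of B2] B by blast
  next
    case False
    have once: "a = a'" if "c \<in> C" "D \<in> {B1, B2}" "a \<in> D" "a' \<in> D" "hit c a" "hit c a'" for c a a' D
      using that False B C(1) hit_block_once[of c D a a'] by blast
    \<comment> \<open>With at most one hit per probe, hitting all \<open>k\<close> points of a block
      would take \<open>k\<close> probes.\<close>
    have unhit: "\<exists>p\<in>D. \<forall>c\<in>C. \<not> hit c p" if D: "D \<in> {B1, B2}" for D
    proof (rule ccontr)
      assume "\<not> ?thesis"
      then obtain f where f: "\<And>p. p \<in> D \<Longrightarrow> f p \<in> C \<and> hit (f p) p" by metis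
      have "inj_on f D"
        by (rule inj_onI) (metis f once[OF _ D])
      then have "card D \<le> card C"
        using f C(2) by (intro card_inj_on_le) auto
      then show False using D B C(3) card_block by auto
    qed
    show ?thesis
    proof (cases "\<exists>p\<in>B1 \<union> B2. p \<noteq> x \<and> (\<forall>c\<in>C. \<not> hit c p)")
      case True
      then obtain p where p: "p \<in> B1 \<union> B2" "p \<noteq> x" "\<forall>c\<in>C. \<not> hit c p" by blast
      \<comment> \<open>Since \<open>p\<close> is not \<open>x\<close>, it lies on only one of the
        two blocks. The unhit point found on the other one may be \<open>x\<close>, but it cannot be
        \<open>p\<close>.\<close>
      obtain D where D: "D \<in> {B1, B2}" "p \<notin> D"
        using p B joining_block_unique[of p x B1 B2] by blast
      obtain q where "q \<in> D" "\<forall>c\<in>C. \<not> hit c q"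
        using unhit[OF D(1)] by blast
      moreover from this have "q \<in> B1 \<union> B2" "p \<noteq> q" using D by auto
      ultimately show ?thesis using p by blast
    next
      case False
      then have hits: "\<exists>c\<in>C. hit c a" if "a \<in> B1 \<union> B2 - {x}" for a
        using that by blast
      have card: "card (D - {x}) = k - 1" "finite (D - {x})" if "D \<in> {B1, B2}" for D
        using that B card_block finite_block by auto
      have "card (B1 - {x}) \<noteq> 0" using card[of B1] k_ge_2 by simp
      then have "B1 - {x} \<noteq> {}" by (metis card.empty)
      then obtain a where "a \<in> B1 - {x}" by blast
      then obtain c where c: "c \<in> C" using hits by blast
      \<comment> \<open>The same \<open>c\<close> is used for both blocks, so the point hit by
        \<open>c\<close> alone on one and its counterpart on the other have equal
        signatures.\<close>
      have single: "\<exists>a\<in>D - {x}. \<forall>c'\<in>C. hit c' a \<longleftrightarrow> c' = c" if D: "D \<in> {B1, B2}" for D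
      proof (rule signature_singleton[OF C(2) _ _ _ _ c])
        show "card C \<le> card (D - {x})" using card[OF D] C(3) by simp
        show "\<exists>c\<in>C. hit c a" if "a \<in> D - {x}" for a using hits[of a] that D by blast
        show "a = a'" if "c \<in> C" "a \<in> D - {x}" "a' \<in> D - {x}" "hit c a" "hit c a'" for c a a'
          using once[OF that(1) D] that(2-) by simp
      qed (rule card[OF D])
      obtain p where p: "p \<in> B1 - {x}" "\<forall>c'\<in>C. hit c' p \<longleftrightarrow> c' = c"
        using single[of B1] by auto
      obtain q where q: "q \<in> B2 - {x}" "\<forall>c'\<in>C. hit c' q \<longleftrightarrow> c' = c"
        using single[of B2] by auto
      have "p \<noteq> q"
        using B p(1) q(1) joining_block_unique[of p x B1 B2] by auto
      moreover have "\<forall>c\<in>C. hit c p \<longleftrightarrow> hit c q"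
        using p(2) q(2) by simp
      ultimately show ?thesis
        using p(1) q(1) by (intro bexI[of _ p] bexI[of _ q]) auto
    qed
  qed
qed

text \<open>The two numerical hypotheses are the bounds of the theorem with denominators cleared.
  Treating every \<open>m\<close> up to \<open>d\<close> at once is what makes the least winning
  number exceed \<open>d\<close>.\<close>

lemma not_cops_can_locate:
  assumes m: "m \<le> d" and d1: "d * min k (r - k) + 2 \<le> r"
    and d2: "d < k \<or> d * (k + 1) + 2 < 2 * ((r - d * min k (r - k)) * (k - 1))"
  shows "\<not> cops_can_locate V E m"
proof -
  obtain x0 where x0: "x0 \<in> X" using points_nonempty by blast
  \<comment> \<open>With the points as \<open>P\<close>, the robber is on blocks in even rounds and
    on points in odd rounds.\<close>
  show ?thesis
  proof (rule evasion[where P = "Inl ` X" and ?x0.0 = "Inl x0"])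
    show "Inl x0 \<in> Inl ` X" using x0 by simp
    show "Inl ` X \<subseteq> V" by auto
  next
    fix u :: "'a + 'a set" and cs
    assume u: "u \<in> Inl ` X" and cs: "length cs = m" "set cs \<subseteq> V"
    from u obtain x where x: "x \<in> X" and u: "u = Inl x" by blast
    obtain T where T: "T \<subseteq> pencil x" "r - d * min k (r - k) \<le> card T"
      "\<forall>B\<in>T. \<forall>B'\<in>T. probe E cs (Inr B) = probe E cs (Inr B')"
      using probe_pencil[OF x cs(2), of d] cs(1) m by blast
    have finT: "finite T" using T(1) by (rule finite_subpencil)
    have "2 \<le> card T" using T(2) d1 by linarith
    then obtain B1 B2 where B12: "B1 \<in> T" "B2 \<in> T" "B1 \<noteq> B2"
      using finT by (metis card_le_Suc0_iff_eq not_less_eq_eq numeral_2_eq_2)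
    have next_probe: "\<exists>p\<in>Inl ` X. \<exists>q\<in>Inl ` X. p \<noteq> q \<and> (\<exists>t\<in>Inr ` T. (t, p) \<in> E)
        \<and> (\<exists>t\<in>Inr ` T. (t, q) \<in> E) \<and> probe E cs' p = probe E cs' q"
      if cs': "length cs' = m" "set cs' \<subseteq> V" for cs'
    proof -
      have "\<exists>p\<in>\<Union>T. \<exists>q\<in>\<Union>T. p \<noteq> q \<and> (\<forall>c\<in>set cs'. hit c p \<longleftrightarrow> hit c q)"
        using d2
      proof
        assume "d < k"
        then have "card (set cs') < k"
          using card_length[of cs'] cs'(1) m by linarith
        then show ?thesis
          using collision_on_two_blocks[of B1 x B2 "set cs'"] B12 T(1) cs'(2) by blast
      next
        assume "d * (k + 1) + 2 < 2 * ((r - d * min k (r - k)) * (k - 1))"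
        also have "\<dots> \<le> 2 * (card T * (k - 1))"
          using T(2) by (intro mult_left_mono mult_right_mono) auto
        finally show ?thesis
          using collision_by_counting[OF x T(1) cs'(2)] cs'(1) m by blast
      qed
      then obtain p q where pq: "p \<in> \<Union>T" "q \<in> \<Union>T" "p \<noteq> q" "\<forall>c\<in>set cs'. hit c p \<longleftrightarrow> hit c q"
        by blast
      then have X: "p \<in> X" "q \<in> X" using T(1) block_subset by blast+
      have "probe E cs' (Inl p) = probe E cs' (Inl q)"
        using probe_eqI[OF cs'(2) X] pq(4) by blast
      then show ?thesis
        using X pq T(1) by (intro bexI[of _ "Inl p"] bexI[of _ "Inl q"]) auto
    qed
    have two: "\<exists>t\<in>Inr ` T. \<exists>t'\<in>Inr ` T. t \<noteq> (t' :: 'a + 'a set)"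
      using B12 by (intro bexI[of _ "Inr B1"] bexI[of _ "Inr B2"]) auto
    have adj: "Inr ` T \<subseteq> V" "\<forall>t\<in>Inr ` T. (u, t) \<in> E"
      using T(1) u by auto
    have same: "\<forall>t\<in>Inr ` T. \<forall>t'\<in>Inr ` T. probe E cs t = probe E cs t'"
    proof (intro ballI, elim imageE)
      fix t t' :: "'a + 'a set" and B B'
      assume "t = Inr B" "B \<in> T" "t' = Inr B'" "B' \<in> T"
      then show "probe E cs t = probe E cs t'"
        by (simp only: T(3)[rule_format, of B B'])
    qed
    show "\<exists>T \<subseteq> V. (\<forall>t\<in>T. (u, t) \<in> E) \<and> (\<exists>t\<in>T. \<exists>t'\<in>T. t \<noteq> t')
        \<and> (\<forall>t\<in>T. \<forall>t'\<in>T. probe E cs t = probe E cs t')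
        \<and> (\<forall>cs'. length cs' = m \<longrightarrow> set cs' \<subseteq> V \<longrightarrow>
            (\<exists>p\<in>Inl ` X. \<exists>q\<in>Inl ` X. p \<noteq> q \<and> (\<exists>t\<in>T. (t, p) \<in> E) \<and> (\<exists>t\<in>T. (t, q) \<in> E)
              \<and> probe E cs' p = probe E cs' q))"
      by (intro exI[of _ "Inr ` T"] conjI allI impI next_probe two adj same)
  qed
qed

lemma cops_can_locate_ex: "\<exists>m. cops_can_locate V E m"
proof -
  have "finite V"
    using finite_points finite_blocks by (simp add: incidence_verts_def)
  then show ?thesis
    using cops_can_locate_card connected by blast
qed

end

theorem theorem2p6:
  fixes X :: "'a set" and \<B> :: "'a set set" and v b r k \<alpha> d :: nat
  assumes "bibd X \<B> v b r k 1"
    and "k < r"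
    and "\<alpha> = min k (r - k)"
    and "d > 0"
    and "real d \<le> (real r - 2) / real \<alpha>"
    and "real d < max (real k)
           ((2 * real r * (real k - 1) - 2) / (real k + 1 + 2 * (real k - 1) * real \<alpha>))"
  shows "localization_number (incidence_verts X \<B>) (incidence_adj X \<B>) > d"
proof -
  interpret linear_design X \<B> v b r k
    using assms by unfold_locales auto
  \<comment> \<open>The division in the first bound is thus by a positive number.\<close>
  have \<alpha>: "\<alpha> \<ge> 1"
    using assms(2,3) k_ge_2 by simp
  have "real d * real \<alpha> \<le> real r - 2"
    using assms(5) \<alpha> by (simp add: pos_le_divide_eq)
  then have "real (d * \<alpha> + 2) \<le> real r"
    by simp
  then have d1: "d * \<alpha> + 2 \<le> r"
    by (simp only: of_nat_le_iff)
  have d2: "d < k \<or> d * (k + 1) + 2 < 2 * ((r - d * \<alpha>) * (k - 1))"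
  proof (cases "d < k")
    case False
    define D where "D = real k + 1 + 2 * (real k - 1) * real \<alpha>"
    have "D > 0"
      unfolding D_def using k_ge_2 by (intro add_pos_nonneg) auto
    have "real d < (2 * real r * (real k - 1) - 2) / D"
      using assms(6) False unfolding D_def by auto
    then have "real d * D < 2 * real r * (real k - 1) - 2"
      using \<open>D > 0\<close> by (simp add: pos_less_divide_eq)
    then have "real d * (real k + 1) + 2 < 2 * ((real r - real d * real \<alpha>) * (real k - 1))"
      unfolding D_def by (simp add: algebra_simps)
    \<comment> \<open>By \<open>d1\<close> and \<open>k_ge_2\<close> neither natural subtraction is
      truncated.\<close>
    also have "\<dots> = real (2 * ((r - d * \<alpha>) * (k - 1)))"
      using d1 k_ge_2 by simp
    finally have "real (d * (k + 1) + 2) < real (2 * ((r - d * \<alpha>) * (k - 1)))"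
      by (simp add: algebra_simps)
    then show ?thesis
      unfolding of_nat_less_iff by (rule disjI2)
  qed simp
  \<comment> \<open>The minimum is attained, so a localization number of at most \<open>d\<close>
    would itself be a winning number of cops.\<close>
  have "cops_can_locate V E (localization_number V E)"
    unfolding localization_number_def using cops_can_locate_ex by (rule LeastI_ex)
  then show ?thesis
    using not_cops_can_locate[OF _ d1[unfolded assms(3)] d2[unfolded assms(3)]] not_less by blast
qed

end
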